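(* Let $b>1$ be an integer and $\alpha\in\{0,\dots,b-1\}$. Let $K_1$ be the sum of the reciprocals $1/n$ over all integers $n>0$ having in base $b$ exactly one occurrence of the string $\alpha\alpha$. Put, for $j\ge0$, $$ \gamma_j' = \sum_{\substack{0\leq d<b\\ d\neq\alpha}} d^j,\qquad \theta_j' = \sum_{\substack{0\leq d<b\\ d\neq\alpha}} (db+\alpha)^j,\qquad \kappa_j' = \sum_{\substack{0\leq d<b\\ d\neq\alpha}}(db^2+\alpha b + \alpha)^j . $$ Let $(u_m)_{m\ge0}$ be the sequence with $u_0=b^2$ verifying for $m\geq1$ $$ \bigl(b^{m+1} - (b-1) - (b-1)b^{-m-1}\bigr)u_m = \sum_{j=1}^m\binom{m}{j}\bigl(\gamma_j'+b^{-m-1}\theta_j'\bigr)u_{m-j}, $$ and let $(v_m)_{m\ge0}$ verify for all $m\geq0$ $$ \bigl(b^{m+1} - (b-1) - (b-1)b^{-m-1}\bigr)v_m = \sum_{j=1}^m\binom{m}{j} \Bigl((\gamma_j' + b^{-m-1} \theta_j')v_{m-j} + b^{-2m-2}\kappa_j' u_{m-j}\Bigr) + (b - 1) b^{-2m-2} u_m . $$ These numbers $u_m$ and $v_m$ are positive and both sequences decrease with limit zero. Let $U$ and $V$ be the functions defined by the (inverse) power series $$ U(n) = \frac{b^2}{n} + \sum_{m=1}^\infty (-1)^m\frac{u_m}{n^{m+1}}, \qquad V(n) = \frac{b(b-1)}{n} + \sum_{m=1}^\infty (-1)^m\frac{v_m}{n^{m+1}} . $$ Then $K_1$ is the following finite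 sum of evaluations of $U$ and $V$ on certain integers having from $2$ to $4$ digits in base $b$: $$ K_1 = \delta_{\alpha\neq0}\, U(\overline{\alpha\alpha}) + \sum_{\substack{1\leq n_1<b\\ 0\leq n_2<b\\ (n_1,n_2)\neq(\alpha,\alpha)}} V(\overline{n_1n_2}) + \sum_{\substack{1\leq n_1<b\\ n_1\neq\alpha}} U(\overline{n_1\alpha\alpha}) + \sum_{\substack{1\leq n_1<b\\ 0\leq n_2<b\\ n_2\neq\alpha}} \Bigl( V(\overline{n_1n_2\alpha}) + U(\overline{n_1n_2\alpha\alpha})\Bigr). $$
   Context: The base-$b$ representation of a positive integer is its minimal one (no leading zeroes). The number of occurrences of $\alpha\alpha$ is the number of positions $i$ such that the $i$-th and $(i+1)$-th digits both equal $\alpha$ (so overlapping occurrences are counted separately; $\alpha\alpha\alpha$ contains two occurrences). $\overline{d_1d_2\dots d_k}$ denotes the integer $d_1b^{k-1}+d_2b^{k-2}+\dots+d_k$. $\delta_{\alpha\neq0}$ is $1$ if $\alpha\ne0$ and $0$ if $\alpha=0$ (in which case the term $\delta_{\alpha\ne0}U(\overline{\alpha\alpha})$ is understood as absent). *)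

theory Defs
  imports "HOL-Analysis.Analysis"
begin

text \<open>Most significant digit first, without leading zeroes; empty for 0 and for bases below 2.\<close>

function digits :: "nat \<Rightarrow> nat \<Rightarrow> nat list" where
  "digits b n = (if b < 2 \<or> n = 0 then [] else digits b (n div b) @ [n mod b])"
  by pat_completeness auto
termination
  by (relation "Wellfounded.measure snd") auto

declare digits.simps [simp del]

definition of_digits :: "nat \<Rightarrow> nat list \<Rightarrow> nat" where
  "of_digits b ds = foldl (\<lambda>n d. n * b + d) 0 ds"

lemma of_digits_digits:
  assumes "b > 1"
  shows "of_digits b (digits b n) = n"
proof (induction n rule: less_induct)
  case (less n)
  show ?case
  proof (cases "n = 0")
    case True
    then show ?thesis by (simp add: digits.simps of_digits_def)
  next
    case False
    with assms have "of_digits b (digits b (n div b)) = n div b"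
      by (intro less) simp
    with False assms show ?thesis
      by (subst digits.simps) (simp add: of_digits_def)
  qed
qed

lemma digits_less: "d \<in> set (digits b n) \<Longrightarrow> d < b"
proof (induction b n rule: digits.induct)
  case (1 b n)
  then show ?case
    by (cases "b < 2 \<or> n = 0") (auto simp: digits.simps[of b n])
qed

lemma hd_digits_pos:
  assumes "b > 1" "n > 0"
  shows "digits b n \<noteq> [] \<and> hd (digits b n) > 0"
  using assms(2)
proof (induction n rule: less_induct)
  case (less n)
  show ?case
  proof (cases "n div b = 0")
    case True
    with assms(1) less.prems show ?thesis
      by (subst (1 2) digits.simps) (auto simp: digits.simps[of b 0] div_eq_0_iff)
  next
    case False
    with assms(1) less.prems
    have "digits b (n div b) \<noteq> [] \<and> hd (digits b (n div b)) > 0"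
      by (intro less) auto
    with assms(1) less.prems show ?thesis
      by (subst (1 2) digits.simps) auto
  qed
qed

definition occurrences :: "nat \<Rightarrow> nat \<Rightarrow> nat \<Rightarrow> nat" where
  "occurrences b \<alpha> n =
     card {i. Suc i < length (digits b n) \<and> digits b n ! i = \<alpha> \<and> digits b n ! Suc i = \<alpha>}"

definition one_occurrence :: "nat \<Rightarrow> nat \<Rightarrow> nat set" where
  "one_occurrence b \<alpha> = {n. n > 0 \<and> occurrences b \<alpha> n = 1}"

definition K1 :: "nat \<Rightarrow> nat \<Rightarrow> real" where
  "K1 b \<alpha> = (\<Sum>\<^sub>\<infinity>n\<in>one_occurrence b \<alpha>. 1 / real n)"

definition gamma' :: "nat \<Rightarrow> nat \<Rightarrow> nat \<Rightarrow> real" where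
  "gamma' b \<alpha> j = (\<Sum>d\<in>{0..<b} - {\<alpha>}. real d ^ j)"

definition theta' :: "nat \<Rightarrow> nat \<Rightarrow> nat \<Rightarrow> real" where
  "theta' b \<alpha> j = (\<Sum>d\<in>{0..<b} - {\<alpha>}. real (d * b + \<alpha>) ^ j)"

definition kappa' :: "nat \<Rightarrow> nat \<Rightarrow> nat \<Rightarrow> real" where
  "kappa' b \<alpha> j = (\<Sum>d\<in>{0..<b} - {\<alpha>}. real (d * b^2 + \<alpha> * b + \<alpha>) ^ j)"

definition lead_factor :: "nat \<Rightarrow> nat \<Rightarrow> real" where
  "lead_factor b m = real b ^ (m + 1) - (real b - 1) - (real b - 1) / real b ^ (m + 1)"

definition u_recurrence :: "nat \<Rightarrow> nat \<Rightarrow> (nat \<Rightarrow> real) \<Rightarrow> bool" where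
  "u_recurrence b \<alpha> u \<longleftrightarrow>
     u 0 = real b ^ 2 \<and>
     (\<forall>m\<ge>1. lead_factor b m * u m =
        (\<Sum>j=1..m. real (m choose j) *
           (gamma' b \<alpha> j + theta' b \<alpha> j / real b ^ (m + 1)) * u (m - j)))"

definition v_recurrence :: "nat \<Rightarrow> nat \<Rightarrow> (nat \<Rightarrow> real) \<Rightarrow> (nat \<Rightarrow> real) \<Rightarrow> bool" where
  "v_recurrence b \<alpha> u v \<longleftrightarrow>
     (\<forall>m. lead_factor b m * v m =
        (\<Sum>j=1..m. real (m choose j) *
           ((gamma' b \<alpha> j + theta' b \<alpha> j / real b ^ (m + 1)) * v (m - j)
            + kappa' b \<alpha> j / real b ^ (2 * m + 2) * u (m - j)))
        + (real b - 1) / real b ^ (2 * m + 2) * u m)"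

definition inv_power_term :: "(nat \<Rightarrow> real) \<Rightarrow> real \<Rightarrow> nat \<Rightarrow> real" where
  "inv_power_term a x m = (-1) ^ m * a m / x ^ (m + 1)"

text \<open>The sums over \<^term>\<open>Suc m\<close> are the series starting at index 1.\<close>

definition U :: "nat \<Rightarrow> (nat \<Rightarrow> real) \<Rightarrow> real \<Rightarrow> real" where
  "U b u x = real b ^ 2 / x + (\<Sum>m. inv_power_term u x (Suc m))"

definition V :: "nat \<Rightarrow> (nat \<Rightarrow> real) \<Rightarrow> real \<Rightarrow> real" where
  "V b v x = real b * (real b - 1) / x + (\<Sum>m. inv_power_term v x (Suc m))"

end

theory Submission
  imports Defs
begin

text \<open>Put a point mass $b^{-|w|}$ at the point $0.w$ (in base $b$) of $[0,1)$ for every digit word $w$ in a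
set of words. The integers that arise by appending such a word to the digits of $n$ are
$b^{|w|} (n + 0.w)$, so the sum of their reciprocals is the integral of $1/(n+x)$ against this
measure. Expanding in powers of $x/n$ turns it into the alternating series in $1/n$ whose
coefficients are the moments of the measure.

Two measures suffice: those of the words that do not start with \<open>\<alpha>\<close> and contain the pair
\<open>\<alpha>\<alpha>\<close> not at all, or exactly once. Forbidding the initial \<open>\<alpha>\<close> makes the number of pairs
additive under prefixing by blocks: with \<open>d \<noteq> \<alpha>\<close>, a nonempty word without a pair is \<open>d w\<close> or
\<open>d \<alpha> w\<close> with \<open>w\<close> of the same kind, and a word with one pair is \<open>d w\<close>, \<open>d \<alpha> w\<close> with \<open>w\<close> of the same
kind, or \<open>d \<alpha> \<alpha> w\<close> with \<open>w\<close> of the first kind (\<open>words_0_decomp\<close>, \<open>words_1_decomp\<close>). This self-similarity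
bounds the total masses, and with the binomial theorem it says that the moments satisfy the two
recurrences (\<open>u_recurrence_word_moment_0\<close>, \<open>v_recurrence_word_moment_1\<close>). The leading factors are
positive, so the recurrences have no other solutions, and $u$ and $v$ are the moment sequences. All
points lie in $[0,1)$ and not all of them are $0$; hence the moments are positive and strictly decrease
to $0$ (\<open>moment_pos\<close>, \<open>moment_Suc_less\<close>, \<open>moment_tendsto_0\<close>) and the series converge
(\<open>moment_series_sums\<close>).

It remains to cut the digit string of an integer with exactly one pair behind its second digit, or
behind the run of \<open>\<alpha>\<close>s that follows there, so that the remainder is a word not starting with \<open>\<alpha>\<close>.
The possible heads are the five families of the formula (\<open>one_pair_words_decomp\<close>).\<close>

section \<open>Moments of point masses in the unit interval\<close>

lemma has_sum_sum:
  fixes f :: "'i \<Rightarrow> 'a \<Rightarrow> 'b::topological_comm_monoid_add"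
  assumes "\<And>i. i \<in> I \<Longrightarrow> (f i has_sum s i) W"
  shows "((\<lambda>w. \<Sum>i\<in>I. f i w) has_sum (\<Sum>i\<in>I. s i)) W"
  using assms by (induction I rule: infinite_finite_induct) (auto intro: has_sum_add)

locale point_masses =
  fixes W :: "'a set" and p x :: "'a \<Rightarrow> real"
  assumes mass_summable: "p summable_on W"
    and mass_pos: "w \<in> W \<Longrightarrow> 0 < p w"
    and location: "w \<in> W \<Longrightarrow> 0 \<le> x w \<and> x w < 1"
begin

definition moment :: "nat \<Rightarrow> real" where
  "moment m = (\<Sum>\<^sub>\<infinity>w\<in>W. p w * x w ^ m)"

text \<open>Bounded functions are integrable, as the total mass is finite.\<close>

lemma bounded_integrand_summable:
  assumes "\<And>w. w \<in> W \<Longrightarrow> 0 \<le> g w \<and> g w \<le> c"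
  shows "(\<lambda>w. p w * g w) summable_on W"
proof (rule summable_on_comparison_test)
  show "(\<lambda>w. p w * c) summable_on W"
    by (intro summable_on_cmult_left mass_summable)
qed (use assms mass_pos in \<open>auto intro!: mult_left_mono simp: less_imp_le\<close>)

lemma moment_summable: "(\<lambda>w. p w * x w ^ m) summable_on W"
  by (rule bounded_integrand_summable[where c = 1]) (use location in \<open>auto intro: power_le_one simp: less_imp_le\<close>)

lemma moment_has_sum: "((\<lambda>w. p w * x w ^ m) has_sum moment m) W"
  unfolding moment_def by (rule has_sum_infsum[OF moment_summable])

lemma moment_pos:
  assumes "w \<in> W" "0 < x w"
  shows "0 < moment m"
  by (rule has_sum_strict_mono[OF has_sum_0 moment_has_sum, where x = w])
     (use assms mass_pos location in \<open>auto intro!: mult_nonneg_nonneg simp: less_imp_le\<close>)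

lemma moment_nonneg: "0 \<le> moment m"
  unfolding moment_def by (rule infsum_nonneg) (use mass_pos location in \<open>auto intro!: mult_nonneg_nonneg simp: less_imp_le\<close>)

lemma moment_Suc_less:
  assumes "w \<in> W" "0 < x w"
  shows "moment (Suc m) < moment m"
proof (rule has_sum_strict_mono[OF moment_has_sum moment_has_sum])
  show "p w * x w ^ Suc m \<le> p w * x w ^ m" if "w \<in> W" for w
    using mass_pos[OF that] location[OF that]
    by (intro mult_left_mono power_decreasing) auto
  show "p w * x w ^ Suc m < p w * x w ^ m"
    using mass_pos[OF assms(1)] location[OF assms(1)] assms(2)
    by (intro mult_strict_left_mono power_strict_decreasing) auto
qed (fact assms)

text \<open>Dominated convergence: up to \<open>r / 2\<close> the mass sits on a finite set, on which the powers of the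
finitely many locations below \<open>1\<close> tend to \<open>0\<close> uniformly.\<close>

lemma moment_tendsto_0: "moment \<longlonglongrightarrow> 0"
proof (rule LIMSEQ_I)
  fix r :: real assume "r > 0"
  obtain F where F: "finite F" "F \<subseteq> W" "dist (sum p F) (infsum p W) \<le> r / 2"
    using infsum_finite_approximation[OF mass_summable, of "r / 2"] \<open>r > 0\<close> by auto
  have "(\<lambda>m. \<Sum>w\<in>F. p w * x w ^ m) \<longlonglongrightarrow> (\<Sum>w\<in>F. p w * 0)"
    using F(2) location by (intro tendsto_intros LIMSEQ_power_zero) force
  then have "\<forall>\<^sub>F m in sequentially. (\<Sum>w\<in>F. p w * x w ^ m) < r / 2"
    using \<open>r > 0\<close> by (intro order_tendstoD(2)) auto
  then obtain M where M: "(\<Sum>w\<in>F. p w * x w ^ m) < r / 2" if "m \<ge> M" for m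
    by (auto simp: eventually_sequentially)
  have "norm (moment m - 0) < r" if "m \<ge> M" for m
  proof -
    have "moment m - (\<Sum>w\<in>F. p w * x w ^ m) = (\<Sum>\<^sub>\<infinity>w\<in>W - F. p w * x w ^ m)"
      unfolding moment_def using F
      by (subst infsum_Diff) (auto intro: moment_summable)
    also have "\<dots> \<le> (\<Sum>\<^sub>\<infinity>w\<in>W - F. p w)"
    proof (rule infsum_mono)
      show "(\<lambda>w. p w * x w ^ m) summable_on W - F" "p summable_on W - F"
        using F by (auto intro!: summable_on_Diff moment_summable mass_summable)
      show "p w * x w ^ m \<le> p w" if "w \<in> W - F" for w
        using mass_pos[of w] location[of w] that
        by (intro mult_right_le_one_le) (auto intro: power_le_one)
    qed
    also have "\<dots> = infsum p W - sum p F"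
      using F by (subst infsum_Diff) (auto intro: mass_summable)
    also have "\<dots> \<le> r / 2"
      using F(3) unfolding dist_real_def by linarith
    finally show ?thesis
      using M[OF that] moment_nonneg[of m] by simp
  qed
  then show "\<exists>M. \<forall>m\<ge>M. norm (moment m - 0) < r"
    by blast
qed

lemma translated_moment_has_sum:
  fixes c :: real
  shows "((\<lambda>w. p w * (c + x w) ^ m) has_sum (\<Sum>j\<le>m. real (m choose j) * c ^ j * moment (m - j))) W"
proof -
  have "((\<lambda>w. \<Sum>j\<le>m. real (m choose j) * c ^ j * (p w * x w ^ (m - j)))
      has_sum (\<Sum>j\<le>m. real (m choose j) * c ^ j * moment (m - j))) W"
    by (intro has_sum_sum has_sum_cmult_right moment_has_sum)
  then show ?thesis
    by (simp add: binomial_ring sum_distrib_left mult_ac)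
qed

lemma inverse_summable:
  assumes "y \<ge> 1"
  shows "(\<lambda>w. p w / (y + x w)) summable_on W"
proof -
  have "0 \<le> 1 / (y + x w) \<and> 1 / (y + x w) \<le> 1" if "w \<in> W" for w
    using location[OF that] assms by (auto simp: field_simps)
  then show ?thesis
    using bounded_integrand_summable[of "\<lambda>w. 1 / (y + x w)" 1] by simp
qed

text \<open>Truncating the geometric series of \<open>1 / (y + t)\<close> with an explicit remainder makes the interchange of
series and integral below a matter of finite sums, and it covers \<open>y = 1\<close> as well, where absolute
convergence may fail.\<close>

lemma geometric_remainder:
  fixes t y :: real
  assumes "0 \<le> t" "y \<ge> 1"
  shows "1 / (y + t) - (\<Sum>m<n. (-1) ^ m * t ^ m / y ^ (m + 1)) = (-1) ^ n * t ^ n / (y ^ n * (y + t))"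
proof (induction n)
  case (Suc n)
  have "1 / (y + t) - (\<Sum>m<Suc n. (-1) ^ m * t ^ m / y ^ (m + 1))
      = (-1) ^ n * t ^ n / (y ^ n * (y + t)) - (-1) ^ n * t ^ n / y ^ (n + 1)"
    using Suc by simp
  also have "\<dots> = (-1) ^ Suc n * t ^ Suc n / (y ^ Suc n * (y + t))"
    using assms by (simp add: divide_simps) (simp add: algebra_simps)
  finally show ?case .
qed simp

text \<open>The error of the \<open>n\<close>-th partial sum is the integral of the geometric remainder, whose denominator is
at least \<open>1\<close>; it is therefore at most the \<open>n\<close>-th moment, which tends to \<open>0\<close>.\<close>

lemma moment_series_sums:
  assumes "y \<ge> 1"
  shows "inv_power_term moment y sums (\<Sum>\<^sub>\<infinity>w\<in>W. p w / (y + x w))"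
proof -
  define S where "S = (\<Sum>\<^sub>\<infinity>w\<in>W. p w / (y + x w))"
  have bound: "\<bar>S - (\<Sum>m<n. inv_power_term moment y m)\<bar> \<le> moment n" for n
  proof -
    have "((\<lambda>w. p w / (y + x w) - (\<Sum>m<n. (-1) ^ m / y ^ (m + 1) * (p w * x w ^ m)))
        has_sum (S - (\<Sum>m<n. (-1) ^ m / y ^ (m + 1) * moment m))) W"
      unfolding S_def diff_conv_add_uminus
      by (intro has_sum_add has_sum_uminusI has_sum_sum has_sum_cmult_right moment_has_sum has_sum_infsum
            inverse_summable assms)
    also have "(\<Sum>m<n. (-1) ^ m / y ^ (m + 1) * moment m) = (\<Sum>m<n. inv_power_term moment y m)"
      by (simp add: inv_power_term_def)
    finally have rem: "((\<lambda>w. p w / (y + x w) - (\<Sum>m<n. (-1) ^ m / y ^ (m + 1) * (p w * x w ^ m)))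
        has_sum (S - (\<Sum>m<n. inv_power_term moment y m))) W" .
    have le: "\<bar>p w / (y + x w) - (\<Sum>m<n. (-1) ^ m / y ^ (m + 1) * (p w * x w ^ m))\<bar> \<le> p w * x w ^ n"
      if "w \<in> W" for w
    proof -
      have "p w / (y + x w) - (\<Sum>m<n. (-1) ^ m / y ^ (m + 1) * (p w * x w ^ m))
          = p w * (1 / (y + x w) - (\<Sum>m<n. (-1) ^ m * x w ^ m / y ^ (m + 1)))"
        by (simp add: right_diff_distrib sum_distrib_left mult_ac)
      also have "\<dots> = p w * ((-1) ^ n * x w ^ n / (y ^ n * (y + x w)))"
        using location[OF that] assms by (subst geometric_remainder) auto
      also have "\<bar>\<dots>\<bar> = p w * (x w ^ n / (y ^ n * (y + x w)))"
        using location[OF that] assms mass_pos[OF that] by (simp add: abs_mult power_abs)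
      also have "\<dots> \<le> p w * (x w ^ n / 1)"
      proof (intro mult_left_mono divide_left_mono)
        have "1 * 1 \<le> y ^ n * (y + x w)"
          using location[OF that] assms by (intro mult_mono) auto
        then show "1 \<le> y ^ n * (y + x w)" by simp
      qed (use location[OF that] mass_pos[OF that] assms in auto)
      finally show ?thesis by simp
    qed
    have ge: "- (p w * x w ^ n) \<le> p w / (y + x w) - (\<Sum>m<n. (-1) ^ m / y ^ (m + 1) * (p w * x w ^ m))"
      if "w \<in> W" for w
      using le[OF that] by linarith
    have "S - (\<Sum>m<n. inv_power_term moment y m) \<le> moment n"
      by (rule has_sum_mono[OF rem moment_has_sum]) (use le in \<open>force simp: abs_le_iff\<close>)
    moreover have "- moment n \<le> S - (\<Sum>m<n. inv_power_term moment y m)"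
      by (rule has_sum_mono[OF has_sum_uminusI[OF moment_has_sum] rem ge])
    ultimately show ?thesis by simp
  qed
  have "(\<lambda>n. S - (\<Sum>m<n. inv_power_term moment y m)) \<longlonglongrightarrow> 0"
    by (rule Lim_null_comparison[OF _ moment_tendsto_0]) (use bound in auto)
  then have "(\<lambda>n. \<Sum>m<n. inv_power_term moment y m) \<longlonglongrightarrow> S"
    using tendsto_diff[OF tendsto_const[of S sequentially]] by fastforce
  then show ?thesis
    by (simp add: sums_def S_def)
qed

end

section \<open>Digit words and pairs of adjacent digits\<close>

lemma of_digits_Nil [simp]: "of_digits b [] = 0"
  by (simp add: of_digits_def)

lemma of_digits_snoc [simp]: "of_digits b (w @ [d]) = of_digits b w * b + d"
  by (simp add: of_digits_def)

lemma of_digits_append: "of_digits b (q @ w) = of_digits b q * b ^ length w + of_digits b w"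
proof (induction w rule: rev_induct)
  case (snoc d w)
  then show ?case
    by (simp flip: append_assoc) (simp add: algebra_simps)
qed simp

lemma of_digits_Cons: "of_digits b (d # w) = d * b ^ length w + of_digits b w"
  using of_digits_append[of b "[d]" w] of_digits_snoc[of b "[]" d] by simp

lemma of_digits_less: "set w \<subseteq> {..<b} \<Longrightarrow> of_digits b w < b ^ length w"
proof (induction w rule: rev_induct)
  case (snoc d w)
  then have "of_digits b w * b + d < of_digits b w * b + b" by simp
  also have "\<dots> = (of_digits b w + 1) * b" by simp
  also have "\<dots> \<le> b ^ length w * b"
    using snoc by (intro mult_right_mono) auto
  finally show ?case by (simp add: mult.commute)
qed simp

lemma digits_of_digits:
  assumes "b > 1" "set w \<subseteq> {..<b}" "w \<noteq> []" "hd w \<noteq> 0"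
  shows "digits b (of_digits b w) = w"
  using assms(2-4)
proof (induction w rule: rev_induct)
  case (snoc d w)
  show ?case
  proof (cases "w = []")
    case True
    then show ?thesis
      using snoc.prems assms(1) of_digits_snoc[of b "[]" d]
      by (simp add: digits.simps[of b d] digits.simps[of b 0])
  next
    case False
    then have IH: "digits b (of_digits b w) = w"
      using snoc by auto
    with False have "of_digits b w \<noteq> 0"
      by (metis assms(1) digits.simps)
    then show ?thesis
      using IH assms(1) snoc.prems by (subst digits.simps) auto
  qed
qed simp

definition pairs :: "nat \<Rightarrow> nat list \<Rightarrow> nat" where
  "pairs \<alpha> w = card {i. Suc i < length w \<and> w ! i = \<alpha> \<and> w ! Suc i = \<alpha>}"

lemma pairs_Nil [simp]: "pairs \<alpha> [] = 0"
  by (simp add: pairs_def)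

lemma pairs_Cons [simp]:
  "pairs \<alpha> (x # w) = (if x = \<alpha> \<and> w \<noteq> [] \<and> hd w = \<alpha> then 1 else 0) + pairs \<alpha> w"
proof -
  let ?P = "\<lambda>w. {i. Suc i < length w \<and> w ! i = \<alpha> \<and> w ! Suc i = \<alpha>}"
  have "?P (x # w) = (if x = \<alpha> \<and> w \<noteq> [] \<and> hd w = \<alpha> then {0} else {}) \<union> Suc ` ?P w"
    (is "_ = ?Z \<union> _")
  proof (rule set_eqI)
    fix i show "i \<in> ?P (x # w) \<longleftrightarrow> i \<in> ?Z \<union> Suc ` ?P w"
      by (cases i) (auto simp: hd_conv_nth)
  qed
  moreover have "finite (?P w)"
    by (rule finite_subset[of _ "{..length w}"]) auto
  ultimately have "card (?P (x # w)) = card ?Z + card (?P w)"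
    by (simp add: card_Un_disjoint card_image disjoint_iff)
  then show ?thesis
    by (simp add: pairs_def)
qed

text \<open>A family of words of equal length, each followed by the same set of words: the shape of every piece
into which words and integers are cut.\<close>

definition prefixed :: "'i set \<Rightarrow> ('i \<Rightarrow> nat list) \<Rightarrow> nat list set \<Rightarrow> nat list set" where
  "prefixed I q S = (\<Union>i\<in>I. (@) (q i) ` S)"

lemma prefixedI: "i \<in> I \<Longrightarrow> w \<in> S \<Longrightarrow> u = q i @ w \<Longrightarrow> u \<in> prefixed I q S"
  by (auto simp: prefixed_def)

lemma prefixed_image: "prefixed I q S = (\<lambda>x. q (fst x) @ snd x) ` (I \<times> S)"
  by (force simp: prefixed_def)

text \<open>Prefixes of equal length are recoverable from the prefixed word, so the pieces for different
prefixes are disjoint.\<close>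

lemma has_sum_prefixed:
  fixes f :: "nat list \<Rightarrow> real"
  assumes "finite I" "inj_on q I" "\<And>i. i \<in> I \<Longrightarrow> length (q i) = n"
    and "\<And>i. i \<in> I \<Longrightarrow> ((\<lambda>w. f (q i @ w)) has_sum s i) S"
  shows "(f has_sum (\<Sum>i\<in>I. s i)) (prefixed I q S)"
  unfolding prefixed_def
proof (rule sum_has_sum)
  show "(f has_sum s i) ((@) (q i) ` S)" if "i \<in> I" for i
    using assms(4)[OF that] by (subst has_sum_reindex) (auto simp: inj_on_def o_def)
  show "(@) (q i) ` S \<inter> (@) (q j) ` S = {}" if "i \<in> I" "j \<in> I" "i \<noteq> j" for i j
    using that assms(3)[of i] assms(3)[of j] inj_onD[OF assms(2), of i j] by auto
qed fact

section \<open>Uniqueness of the solutions of the recurrences\<close>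

text \<open>With $B = b^{m+1} \<ge> b$ the factor is $(B - (b-1)) - (b-1)/B$, a number at least $1$ minus a number
below $1$.\<close>

lemma lead_factor_pos:
  assumes "b > 1"
  shows "lead_factor b m > 0"
proof -
  have B: "real b ^ 1 \<le> real b ^ (m + 1)"
    using assms by (intro power_increasing) auto
  then have "real b - 1 < real b ^ (m + 1)"
    unfolding power_one_right by linarith
  then have "(real b - 1) / real b ^ (m + 1) < 1"
    using assms by (subst pos_divide_less_eq) auto
  then show ?thesis
    using B unfolding lead_factor_def by simp
qed

lemma u_recurrence_unique:
  assumes "b > 1" "u_recurrence b \<alpha> u" "u_recurrence b \<alpha> u'"
  shows "u = u'"
proof
  fix m show "u m = u' m"
  proof (induction m rule: less_induct)
    case (less m)
    show ?case
    proof (cases "m = 0")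
      case False
      have "lead_factor b m * u m = lead_factor b m * u' m"
        using assms(2,3) False less unfolding u_recurrence_def by (auto intro!: sum.cong)
      then show ?thesis
        using lead_factor_pos[OF assms(1), of m] by simp
    qed (use assms(2,3) in \<open>simp add: u_recurrence_def\<close>)
  qed
qed

lemma v_recurrence_unique:
  assumes "b > 1" "v_recurrence b \<alpha> u v" "v_recurrence b \<alpha> u v'"
  shows "v = v'"
proof
  fix m show "v m = v' m"
  proof (induction m rule: less_induct)
    case (less m)
    have "lead_factor b m * v m = lead_factor b m * v' m"
      using assms(2,3) less unfolding v_recurrence_def by (auto intro!: sum.cong)
    then show ?case
      using lead_factor_pos[OF assms(1), of m] by simp
  qed
qed

text \<open>Moves the term containing the unknown of index \<open>m\<close> out of the binomial sum; in the recurrences it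
contributes to the leading factor.\<close>

lemma sum_atMost_head: "(\<Sum>j\<le>m. g j :: real) = g 0 + (\<Sum>j=1..m. g j)" for m :: nat
proof -
  have "{..m} = insert 0 {1..m}" by auto
  then show ?thesis by simp
qed

text \<open>Stated for variables, because simplification would multiply out the sums that take their places.\<close>

lemma clear_denominators:
  fixes B :: real
  assumes "B > 0"
  shows "a = z + (x / B + y / (B * B)) \<Longrightarrow> B * a = B * z + x + y / B"
    and "a = x / B + y / (B * B) + k / (B * B * B) \<Longrightarrow> B * a = x + y / B + k / (B * B)"
  using assms by (simp_all add: field_simps)

section \<open>Words not starting with the repeated digit\<close>

locale digit_words =
  fixes b \<alpha> :: nat
  assumes base: "b > 1" and digit: "\<alpha> < b"
begin

definition weight :: "nat list \<Rightarrow> real" where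
  "weight w = 1 / real b ^ length w"

definition frac_val :: "nat list \<Rightarrow> real" where
  "frac_val w = real (of_digits b w) / real b ^ length w"

definition other_digits :: "nat set" where
  "other_digits = {0..<b} - {\<alpha>}"

definition words :: "nat \<Rightarrow> nat list set" where
  "words k = {w. set w \<subseteq> {..<b} \<and> (w = [] \<or> hd w \<noteq> \<alpha>) \<and> pairs \<alpha> w = k}"

lemma finite_other_digits [simp]: "finite other_digits"
  by (simp add: other_digits_def)

lemma card_other_digits: "real (card other_digits) = real b - 1"
  using base digit by (simp add: other_digits_def)

text \<open>A first digit other than \<open>\<alpha>\<close> forms no pair with its successor; hence the rest of the word has the same
pairs, but it may start with \<open>\<alpha>\<close>.\<close>

lemma Cons_in_words_iff: "d # r \<in> words k \<longleftrightarrow> d \<in> other_digits \<and> set r \<subseteq> {..<b} \<and> pairs \<alpha> r = k"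
  by (auto simp: words_def other_digits_def)

lemma Cons_in_prefixed_iff:
  "d # r \<in> prefixed other_digits (\<lambda>d. d # q) S \<longleftrightarrow> d \<in> other_digits \<and> r \<in> (@) q ` S"
  by (auto simp: prefixed_def)

lemma Cons_image_append: "e # s \<in> (@) (d # q) ` S \<longleftrightarrow> e = d \<and> s \<in> (@) q ` S"
  by auto

text \<open>Behind a first digit other than \<open>\<alpha>\<close> comes a run of at most one \<open>\<alpha>\<close>, since a longer run contains a
pair. What follows this run does not start with \<open>\<alpha>\<close>.\<close>

lemma words_0_decomp:
  "words 0 = {[]} \<union> (prefixed other_digits (\<lambda>d. [d]) (words 0) \<union> prefixed other_digits (\<lambda>d. [d, \<alpha>]) (words 0))" (is "_ = ?R")
proof (rule set_eqI)
  fix w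
  show "w \<in> words 0 \<longleftrightarrow> w \<in> ?R"
  proof (cases w)
    case Nil
    then show ?thesis by (simp add: words_def)
  next
    case (Cons d r)
    have "set r \<subseteq> {..<b} \<and> pairs \<alpha> r = 0 \<longleftrightarrow> r \<in> words 0 \<or> r \<in> (@) [\<alpha>] ` words 0"
    proof (cases r)
      case (Cons e s)
      then show ?thesis
        using digit unfolding Cons_image_append by (auto simp: words_def)
    qed (simp add: words_def)
    then show ?thesis
      unfolding Cons Cons_in_words_iff Un_iff Cons_in_prefixed_iff by auto
  qed
qed

text \<open>The run of \<open>\<alpha>\<close>s behind the first digit may now have length two; it then uses up the only pair, and
what follows has none.\<close>

lemma words_1_decomp:
  "words 1 = prefixed other_digits (\<lambda>d. [d]) (words 1) \<union> prefixed other_digits (\<lambda>d. [d, \<alpha>]) (words 1)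
     \<union> prefixed other_digits (\<lambda>d. [d, \<alpha>, \<alpha>]) (words 0)" (is "_ = ?R")
proof (rule set_eqI)
  fix w
  show "w \<in> words 1 \<longleftrightarrow> w \<in> ?R"
  proof (cases w)
    case Nil
    then show ?thesis by (auto simp: words_def prefixed_def)
  next
    case (Cons d r)
    have "set r \<subseteq> {..<b} \<and> pairs \<alpha> r = 1 \<longleftrightarrow>
        r \<in> words 1 \<or> r \<in> (@) [\<alpha>] ` words 1 \<or> r \<in> (@) [\<alpha>, \<alpha>] ` words 0"
    proof (cases r)
      case (Cons e s)
      have "set s \<subseteq> {..<b} \<and> pairs \<alpha> (\<alpha> # s) = 1 \<longleftrightarrow> s \<in> words 1 \<or> s \<in> (@) [\<alpha>] ` words 0"
      proof (cases s)
        case (Cons c t)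
        then show ?thesis
          using digit unfolding Cons_image_append by (auto simp: words_def)
      qed (auto simp: words_def)
      with Cons show ?thesis
        using digit unfolding Cons_image_append by (auto simp: words_def)
    qed (auto simp: words_def)
    then show ?thesis
      unfolding Cons Cons_in_words_iff Un_iff Cons_in_prefixed_iff by auto
  qed
qed

lemma weight_append: "weight (q @ w) = weight w / real b ^ length q"
  by (simp add: weight_def power_add)

lemma frac_val_append: "frac_val (q @ w) = (real (of_digits b q) + frac_val w) / real b ^ length q"
  using base by (simp add: frac_val_def of_digits_append power_add field_simps)

text \<open>Finite truncations, on which the recursive estimate of the mass can be carried out before
summability is known.\<close>

definition short_words :: "nat \<Rightarrow> nat \<Rightarrow> nat list set" where
  "short_words k n = {w \<in> words k. length w < n}"

lemma finite_short [simp]: "finite (short_words k n)"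
  by (rule finite_subset[OF _ finite_lists_length_le[of "{..<b}" n]]) (auto simp: short_words_def words_def)

lemma weight_nonneg: "0 \<le> weight w"
  by (simp add: weight_def)

lemma finite_prefixed: "finite I \<Longrightarrow> finite S \<Longrightarrow> finite (prefixed I q S)"
  by (auto simp: prefixed_def)

lemma sum_weight_Un_le:
  "finite A \<Longrightarrow> finite B \<Longrightarrow> sum weight (A \<union> B) \<le> sum weight A + sum weight B"
  by (simp add: sum_Un sum_nonneg weight_nonneg)

lemma sum_weight_prefixed_le:
  assumes "finite S" "\<And>d. length (q d) = l"
  shows "sum weight (prefixed other_digits q S) \<le> (real b - 1) / real b ^ l * sum weight S"
proof -
  have "sum weight (prefixed other_digits q S) \<le> (\<Sum>x\<in>other_digits\<times>S. weight (q (fst x) @ snd x))"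
    using sum_image_le[of "other_digits \<times> S" weight "\<lambda>x. q (fst x) @ snd x"] assms(1) weight_nonneg
    by (simp add: prefixed_image o_def)
  also have "\<dots> = (\<Sum>d\<in>other_digits. \<Sum>w\<in>S. weight w / real b ^ l)"
    using assms(2) by (subst sum.cartesian_product) (simp add: weight_append case_prod_unfold)
  also have "\<dots> = (real b - 1) / real b ^ l * sum weight S"
    by (simp add: card_other_digits flip: sum_divide_distrib)
  finally show ?thesis .
qed

text \<open>The decomposition gives \<open>s\<^sub>n\<^sub>+\<^sub>1 \<le> 1 + ((b-1)/b + (b-1)/b\<^sup>2) s\<^sub>n = 1 + (1 - 1/b\<^sup>2) s\<^sub>n\<close> for the masses
\<open>s\<^sub>n\<close> of the truncations, and \<open>b\<^sup>2\<close> is the fixed point of this affine map.\<close>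

lemma short_0_bound: "sum weight (short_words 0 n) \<le> real b ^ 2"
proof (induction n)
  case (Suc n)
  have sub: "short_words 0 (Suc n) \<subseteq> {[]} \<union> (prefixed other_digits (\<lambda>d. [d]) (short_words 0 n) \<union> prefixed other_digits (\<lambda>d. [d, \<alpha>]) (short_words 0 n))"
    (is "_ \<subseteq> _ \<union> (?A \<union> ?B)")
    unfolding short_words_def by (subst words_0_decomp) (auto simp: prefixed_def)
  have fin: "finite ?A" "finite ?B"
    by (simp_all add: finite_prefixed del: One_nat_def)
  have "sum weight (short_words 0 (Suc n)) \<le> sum weight ({[]} \<union> (?A \<union> ?B))"
    using sub by (rule sum_mono2[rotated]) (simp_all add: fin weight_nonneg del: One_nat_def)
  also have "\<dots> \<le> sum weight {[]} + (sum weight ?A + sum weight ?B)"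
    using fin by (intro order.trans[OF sum_weight_Un_le] add_mono sum_weight_Un_le) auto
  also have "\<dots> \<le> 1 + ((real b - 1) / real b ^ 1 * sum weight (short_words 0 n)
      + (real b - 1) / real b ^ 2 * sum weight (short_words 0 n))"
    by (intro add_mono sum_weight_prefixed_le) (auto simp: weight_def)
  also have "\<dots> \<le> 1 + ((real b - 1) / real b ^ 1 * real b ^ 2 + (real b - 1) / real b ^ 2 * real b ^ 2)"
    using base Suc by (intro add_mono mult_left_mono) auto
  also have "\<dots> = real b ^ 2"
    using base by (simp add: field_simps power2_eq_square)
  finally show ?case .
qed (simp add: short_words_def)

text \<open>As before, with the fixed point of \<open>s \<mapsto> (1 - 1/b\<^sup>2) s + (b-1)/b\<close>, where the constant term is the
bound \<open>b\<^sup>2\<close> for the words without a pair times the factor \<open>(b-1)/b\<^sup>3\<close> of the prefixes \<open>d \<alpha> \<alpha>\<close>.\<close>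

lemma short_1_bound: "sum weight (short_words 1 n) \<le> real b * (real b - 1)"
proof (induction n)
  case (Suc n)
  have sub: "short_words 1 (Suc n) \<subseteq> prefixed other_digits (\<lambda>d. [d]) (short_words 1 n) \<union> prefixed other_digits (\<lambda>d. [d, \<alpha>]) (short_words 1 n)
      \<union> prefixed other_digits (\<lambda>d. [d, \<alpha>, \<alpha>]) (short_words 0 n)"
    (is "_ \<subseteq> ?A \<union> ?B \<union> ?C")
    unfolding short_words_def by (subst words_1_decomp) (auto simp: prefixed_def)
  have fin: "finite ?A" "finite ?B" "finite ?C"
    by (simp_all add: finite_prefixed del: One_nat_def)
  have "sum weight (short_words 1 (Suc n)) \<le> sum weight (?A \<union> ?B \<union> ?C)"
    using sub by (rule sum_mono2[rotated]) (simp_all add: fin weight_nonneg del: One_nat_def)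
  also have "\<dots> \<le> (sum weight ?A + sum weight ?B) + sum weight ?C"
    using sum_weight_Un_le[OF finite_UnI[OF fin(1,2)] fin(3)] sum_weight_Un_le[OF fin(1,2)]
    by linarith
  also have "\<dots> \<le> ((real b - 1) / real b ^ 1 * sum weight (short_words 1 n)
      + (real b - 1) / real b ^ 2 * sum weight (short_words 1 n)) + (real b - 1) / real b ^ 3 * sum weight (short_words 0 n)"
    by (intro add_mono sum_weight_prefixed_le) auto
  also have "\<dots> \<le> ((real b - 1) / real b ^ 1 * (real b * (real b - 1))
      + (real b - 1) / real b ^ 2 * (real b * (real b - 1))) + (real b - 1) / real b ^ 3 * real b ^ 2"
    using base Suc by (intro add_mono mult_left_mono short_0_bound) auto
  also have "\<dots> = real b * (real b - 1)"
    using base by (simp add: field_simps power2_eq_square power3_eq_cube)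
  finally show ?case .
qed (use base in \<open>simp add: short_words_def\<close>)

lemma weight_summable:
  assumes "k \<le> 1"
  shows "weight summable_on words k"
proof (rule nonneg_bdd_above_summable_on)
  show "bdd_above (sum weight ` {F. F \<subseteq> words k \<and> finite F})"
  proof (rule bdd_aboveI2)
    fix F assume F: "F \<in> {F. F \<subseteq> words k \<and> finite F}"
    define n where "n = Suc (Max (insert 0 (length ` F)))"
    have "F \<subseteq> short_words k n"
      using F by (auto simp: short_words_def n_def less_Suc_eq_le)
    then have "sum weight F \<le> sum weight (short_words k n)"
      by (intro sum_mono2) (auto simp: weight_nonneg)
    also have "\<dots> \<le> real b ^ 2 + real b * (real b - 1)"
      using assms short_0_bound[of n] short_1_bound[of n] base
      by (cases "k = 0") (auto simp: le_Suc_eq intro: order_trans)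
    finally show "sum weight F \<le> real b ^ 2 + real b * (real b - 1)" .
  qed
qed (simp add: weight_nonneg)

lemma word_masses:
  assumes "k \<le> 1"
  shows "point_masses (words k) weight frac_val"
proof
  show "weight summable_on words k"
    by (rule weight_summable) fact
  show "0 < weight w" if "w \<in> words k" for w
    using base by (simp add: weight_def)
  show "0 \<le> frac_val w \<and> frac_val w < 1" if "w \<in> words k" for w
    using of_digits_less[of w b] that base by (simp add: frac_val_def words_def flip: of_nat_power)
qed

section \<open>The moments of the words satisfy the recurrences\<close>

definition word_moment :: "nat \<Rightarrow> nat \<Rightarrow> real" where
  "word_moment k = point_masses.moment (words k) weight frac_val"

lemma word_moment_has_sum: "k \<le> 1 \<Longrightarrow> ((\<lambda>w. weight w * frac_val w ^ m) has_sum word_moment k m) (words k)"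
  unfolding word_moment_def by (rule point_masses.moment_has_sum[OF word_masses])

text \<open>Prefixing by \<open>q\<close> moves \<open>x\<close> to \<open>(q + x) / b\<^sup>n\<close> and divides the mass by \<open>b\<^sup>n\<close>. The binomial theorem then
expresses the moments of the piece by those of the original words and the power sums of the
prefixes, which are \<open>\<gamma>'\<close>, \<open>\<theta>'\<close> and \<open>\<kappa>'\<close> for the prefixes \<open>d\<close>, \<open>d \<alpha>\<close> and \<open>d \<alpha> \<alpha>\<close>.\<close>

lemma prefixed_moment:
  assumes "k \<le> 1" "finite I" "inj_on q I" "\<And>i. i \<in> I \<Longrightarrow> length (q i) = n"
  shows "((\<lambda>w. weight w * frac_val w ^ m) has_sum
     (\<Sum>j\<le>m. real (m choose j) * (\<Sum>i\<in>I. real (of_digits b (q i)) ^ j) * word_moment k (m - j)) / real b ^ (n * (m + 1)))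
     (prefixed I q (words k))"
proof -
  have "((\<lambda>w. weight w * frac_val w ^ m) has_sum
     (\<Sum>i\<in>I. (\<Sum>j\<le>m. real (m choose j) * real (of_digits b (q i)) ^ j * word_moment k (m - j)) / real b ^ (n * (m + 1))))
     (prefixed I q (words k))"
  proof (rule has_sum_prefixed[OF assms(2-4)])
    fix i assume i: "i \<in> I"
    have "weight (q i @ w) * frac_val (q i @ w) ^ m
        = weight w * (real (of_digits b (q i)) + frac_val w) ^ m * (1 / real b ^ (n * (m + 1)))" for w
      using assms(4)[OF i]
      by (simp add: weight_append frac_val_append power_divide power_add mult.commute flip: power_mult)
    then show "((\<lambda>w. weight (q i @ w) * frac_val (q i @ w) ^ m) has_sum
        (\<Sum>j\<le>m. real (m choose j) * real (of_digits b (q i)) ^ j * word_moment k (m - j)) / real b ^ (n * (m + 1))) (words k)"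
      using has_sum_cmult_left[OF point_masses.translated_moment_has_sum[OF word_masses[OF assms(1)],
            of "real (of_digits b (q i))" m], of "1 / real b ^ (n * (m + 1))"]
      by (simp add: word_moment_def)
  qed
  also have "(\<Sum>i\<in>I. (\<Sum>j\<le>m. real (m choose j) * real (of_digits b (q i)) ^ j * word_moment k (m - j)) / real b ^ (n * (m + 1)))
    = (\<Sum>j\<le>m. real (m choose j) * (\<Sum>i\<in>I. real (of_digits b (q i)) ^ j) * word_moment k (m - j)) / real b ^ (n * (m + 1))"
    unfolding sum_divide_distrib[symmetric]
    by (subst sum.swap) (simp add: sum_distrib_left sum_distrib_right)
  finally show ?thesis .
qed

lemma moment_d:
  assumes "k \<le> 1"
  shows "((\<lambda>w. weight w * frac_val w ^ m) has_sum
     (\<Sum>j\<le>m. real (m choose j) * gamma' b \<alpha> j * word_moment k (m - j)) / real b ^ (m + 1)) (prefixed other_digits (\<lambda>d. [d]) (words k))"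
  using prefixed_moment[OF assms finite_other_digits, of "\<lambda>d. [d]" 1 m]
  by (simp add: gamma'_def other_digits_def of_digits_Cons inj_on_def)

lemma moment_da:
  assumes "k \<le> 1"
  shows "((\<lambda>w. weight w * frac_val w ^ m) has_sum
     (\<Sum>j\<le>m. real (m choose j) * theta' b \<alpha> j * word_moment k (m - j)) / real b ^ (2 * (m + 1))) (prefixed other_digits (\<lambda>d. [d, \<alpha>]) (words k))"
  using prefixed_moment[OF assms finite_other_digits, of "\<lambda>d. [d, \<alpha>]" 2 m]
  by (simp add: theta'_def other_digits_def of_digits_Cons inj_on_def)

lemma moment_daa:
  assumes "k \<le> 1"
  shows "((\<lambda>w. weight w * frac_val w ^ m) has_sum
     (\<Sum>j\<le>m. real (m choose j) * kappa' b \<alpha> j * word_moment k (m - j)) / real b ^ (3 * (m + 1))) (prefixed other_digits (\<lambda>d. [d, \<alpha>, \<alpha>]) (words k))"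
  using prefixed_moment[OF assms finite_other_digits, of "\<lambda>d. [d, \<alpha>, \<alpha>]" 3 m]
  by (simp add: kappa'_def other_digits_def of_digits_Cons inj_on_def power2_eq_square add.assoc)

text \<open>The empty word contributes \<open>0 ^ m\<close>, its mass being at \<open>0\<close>. This source term is what fixes
the total mass \<open>u\<^sub>0\<close>.\<close>

lemma word_moment_0_eq:
  "word_moment 0 m = 0 ^ m + ((\<Sum>j\<le>m. real (m choose j) * gamma' b \<alpha> j * word_moment 0 (m - j)) / real b ^ (m + 1)
     + (\<Sum>j\<le>m. real (m choose j) * theta' b \<alpha> j * word_moment 0 (m - j)) / real b ^ (2 * (m + 1)))"
proof -
  have "((\<lambda>w. weight w * frac_val w ^ m) has_sum 0 ^ m) {[]}"
    by (simp add: weight_def frac_val_def has_sum_finite_iff)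
  then show ?thesis
    by (intro has_sum_unique[OF word_moment_has_sum[of 0 m]])
       (simp, subst words_0_decomp, intro has_sum_Un_disjoint moment_d moment_da, auto simp: prefixed_def words_def)
qed

lemma word_moment_1_eq:
  "word_moment 1 m = (\<Sum>j\<le>m. real (m choose j) * gamma' b \<alpha> j * word_moment 1 (m - j)) / real b ^ (m + 1)
     + (\<Sum>j\<le>m. real (m choose j) * theta' b \<alpha> j * word_moment 1 (m - j)) / real b ^ (2 * (m + 1))
     + (\<Sum>j\<le>m. real (m choose j) * kappa' b \<alpha> j * word_moment 0 (m - j)) / real b ^ (3 * (m + 1))"
  by (rule has_sum_unique[OF word_moment_has_sum[of 1 m]])
     (simp, subst words_1_decomp, intro has_sum_Un_disjoint moment_d moment_da moment_daa, auto simp: prefixed_def words_def)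

lemma power_sums_0:
  "gamma' b \<alpha> 0 = real b - 1" "theta' b \<alpha> 0 = real b - 1" "kappa' b \<alpha> 0 = real b - 1"
  using base digit by (simp_all add: gamma'_def theta'_def kappa'_def)

lemma word_moment_0_relation:
  "lead_factor b m * word_moment 0 m = real b ^ (m + 1) * 0 ^ m
     + (\<Sum>j=1..m. real (m choose j) * (gamma' b \<alpha> j + theta' b \<alpha> j / real b ^ (m + 1)) * word_moment 0 (m - j))"
proof -
  define B where "B = real b ^ (m + 1)"
  define G where "G = (\<Sum>j=1..m. real (m choose j) * gamma' b \<alpha> j * word_moment 0 (m - j))"
  define T where "T = (\<Sum>j=1..m. real (m choose j) * theta' b \<alpha> j * word_moment 0 (m - j))"
  have B: "B > 0" "real b ^ (2 * (m + 1)) = B * B"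
    using base by (simp_all add: B_def mult_2 power_add)
  have "word_moment 0 m = 0 ^ m + (((real b - 1) * word_moment 0 m + G) / B + ((real b - 1) * word_moment 0 m + T) / (B * B))"
    using word_moment_0_eq[of m] unfolding B(2) B_def[symmetric] sum_atMost_head G_def T_def
    by (simp add: power_sums_0)
  then have "B * word_moment 0 m = B * 0 ^ m + ((real b - 1) * word_moment 0 m + G) + ((real b - 1) * word_moment 0 m + T) / B"
    by (rule clear_denominators(1)[OF B(1)])
  moreover have "(\<Sum>j=1..m. real (m choose j) * (gamma' b \<alpha> j + theta' b \<alpha> j / B) * word_moment 0 (m - j)) = G + T / B"
    by (simp add: G_def T_def algebra_simps sum.distrib sum_divide_distrib)
  ultimately show ?thesis
    unfolding lead_factor_def B_def[symmetric] by (simp add: algebra_simps add_divide_distrib diff_divide_distrib)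
qed

lemma u_recurrence_word_moment_0: "u_recurrence b \<alpha> (word_moment 0)"
  unfolding u_recurrence_def
proof (intro conjI allI impI)
  show "word_moment 0 0 = real b ^ 2"
    using word_moment_0_relation[of 0] base by (simp add: lead_factor_def field_simps power2_eq_square)
  show "lead_factor b m * word_moment 0 m = (\<Sum>j=1..m. real (m choose j) *
           (gamma' b \<alpha> j + theta' b \<alpha> j / real b ^ (m + 1)) * word_moment 0 (m - j))" if "m \<ge> 1" for m
    using word_moment_0_relation[of m] that by simp
qed

lemma v_recurrence_word_moment_1: "v_recurrence b \<alpha> (word_moment 0) (word_moment 1)"
  unfolding v_recurrence_def
proof
  fix m
  define B where "B = real b ^ (m + 1)"
  define G where "G = (\<Sum>j=1..m. real (m choose j) * gamma' b \<alpha> j * word_moment 1 (m - j))"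
  define T where "T = (\<Sum>j=1..m. real (m choose j) * theta' b \<alpha> j * word_moment 1 (m - j))"
  define K where "K = (\<Sum>j=1..m. real (m choose j) * kappa' b \<alpha> j * word_moment 0 (m - j))"
  have e: "2 * (m + 1) = (m + 1) + (m + 1)" "3 * (m + 1) = (m + 1) + (m + 1) + (m + 1)"
      "2 * m + 2 = (m + 1) + (m + 1)"
    by simp_all
  have B: "B > 0" "real b ^ (2 * (m + 1)) = B * B" "real b ^ (3 * (m + 1)) = B * B * B"
      "real b ^ (2 * m + 2) = B * B"
    using base by (simp_all only: e power_add B_def) simp
  have "word_moment 1 m = ((real b - 1) * word_moment 1 m + G) / B + ((real b - 1) * word_moment 1 m + T) / (B * B)
      + ((real b - 1) * word_moment 0 m + K) / (B * B * B)"
    using word_moment_1_eq[of m] unfolding B(2,3) B_def[symmetric] sum_atMost_head G_def T_def K_def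
    by (simp add: power_sums_0)
  then have "B * word_moment 1 m = ((real b - 1) * word_moment 1 m + G) + ((real b - 1) * word_moment 1 m + T) / B
      + ((real b - 1) * word_moment 0 m + K) / (B * B)"
    by (rule clear_denominators(2)[OF B(1)])
  moreover have "(\<Sum>j=1..m. real (m choose j) * ((gamma' b \<alpha> j + theta' b \<alpha> j / B) * word_moment 1 (m - j)
      + kappa' b \<alpha> j / (B * B) * word_moment 0 (m - j))) = G + T / B + K / (B * B)"
    by (simp add: G_def T_def K_def algebra_simps sum.distrib sum_divide_distrib)
  ultimately show "lead_factor b m * word_moment 1 m = (\<Sum>j=1..m. real (m choose j) *
      ((gamma' b \<alpha> j + theta' b \<alpha> j / real b ^ (m + 1)) * word_moment 1 (m - j)
       + kappa' b \<alpha> j / real b ^ (2 * m + 2) * word_moment 0 (m - j)))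
      + (real b - 1) / real b ^ (2 * m + 2) * word_moment 0 m"
    unfolding lead_factor_def B(4) B_def[symmetric] by (simp add: algebra_simps add_divide_distrib diff_divide_distrib)
qed

text \<open>The recurrence at index \<open>0\<close> determines the first coefficient of \<open>V\<close>.\<close>

lemma word_moment_1_0: "word_moment 1 0 = real b * (real b - 1)"
proof -
  have "lead_factor b 0 * word_moment 1 0 = (real b - 1) / real b ^ 2 * word_moment 0 0"
    using v_recurrence_word_moment_1[unfolded v_recurrence_def, rule_format, of 0] by (simp add: power2_eq_square)
  moreover have "word_moment 0 0 = real b ^ 2"
    using u_recurrence_word_moment_0 by (simp add: u_recurrence_def)
  moreover have "lead_factor b 0 = 1 / real b"
    using base by (simp add: lead_factor_def field_simps)
  ultimately have "word_moment 1 0 / real b = real b - 1"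
    using base by simp
  then show ?thesis
    using base by (simp add: field_simps)
qed

section \<open>Reciprocals of integers with exactly one pair\<close>

text \<open>By \<open>prefixed_reciprocals\<close> this is the sum of the reciprocals of the integers whose digits are those of
\<open>n\<close> followed by a word in \<open>words k\<close>.\<close>

definition tail_sum :: "nat \<Rightarrow> nat \<Rightarrow> real" where
  "tail_sum k n = (\<Sum>\<^sub>\<infinity>w\<in>words k. weight w / (real n + frac_val w))"

lemma series_sums:
  "k \<le> 1 \<Longrightarrow> y \<ge> 1 \<Longrightarrow> inv_power_term (word_moment k) y sums (\<Sum>\<^sub>\<infinity>w\<in>words k. weight w / (y + frac_val w))"
  using point_masses.moment_series_sums[OF word_masses, of k y] by (simp add: word_moment_def)

lemma series_value:
  assumes "k \<le> 1" "n \<ge> 1"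
  shows "word_moment k 0 / real n + (\<Sum>m. inv_power_term (word_moment k) (real n) (Suc m)) = tail_sum k n"
proof -
  have "inv_power_term (word_moment k) (real n) sums tail_sum k n"
    using series_sums[OF assms(1), of "real n"] assms(2) by (simp add: tail_sum_def)
  then have "inv_power_term (word_moment k) (real n) 0 + (\<Sum>m. inv_power_term (word_moment k) (real n) (Suc m)) = tail_sum k n"
    using suminf_split_head[of "inv_power_term (word_moment k) (real n)"] by (simp add: sums_iff)
  then show ?thesis
    by (simp add: inv_power_term_def)
qed

lemma U_eq_tail_sum: "n \<ge> 1 \<Longrightarrow> U b (word_moment 0) (real n) = tail_sum 0 n"
  using series_value[of 0 n] u_recurrence_word_moment_0 by (simp add: U_def u_recurrence_def)

lemma V_eq_tail_sum: "n \<ge> 1 \<Longrightarrow> V b (word_moment 1) (real n) = tail_sum 1 n"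
  using series_value[of 1 n] word_moment_1_0 by (simp add: V_def)

lemma prefixed_reciprocals:
  assumes "k \<le> 1" "finite I" "inj_on q I" "\<And>i. i \<in> I \<Longrightarrow> length (q i) = n"
    and "\<And>i. i \<in> I \<Longrightarrow> of_digits b (q i) \<ge> 1"
  shows "((\<lambda>w. 1 / real (of_digits b w)) has_sum (\<Sum>i\<in>I. tail_sum k (of_digits b (q i)))) (prefixed I q (words k))"
proof (rule has_sum_prefixed[OF assms(2-4)])
  fix i assume "i \<in> I"
  have "1 / real (of_digits b (q i @ w)) = weight w / (real (of_digits b (q i)) + frac_val w)" for w
    using base by (simp add: of_digits_append weight_def frac_val_def field_simps)
  then show "((\<lambda>w. 1 / real (of_digits b (q i @ w))) has_sum tail_sum k (of_digits b (q i))) (words k)"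
    using assms(5)[OF \<open>i \<in> I\<close>] point_masses.inverse_summable[OF word_masses[OF assms(1)]]
    by (simp add: tail_sum_def)
qed

definition one_pair_words :: "nat list set" where
  "one_pair_words = {w. set w \<subseteq> {..<b} \<and> w \<noteq> [] \<and> hd w \<noteq> 0 \<and> pairs \<alpha> w = 1}"

lemma bij_betw_of_digits: "bij_betw (of_digits b) one_pair_words (one_occurrence b \<alpha>)"
proof (rule bij_betw_byWitness[where f' = "digits b"])
  show "\<forall>w\<in>one_pair_words. digits b (of_digits b w) = w"
    using base by (auto simp: one_pair_words_def intro: digits_of_digits)
  show "\<forall>n\<in>one_occurrence b \<alpha>. of_digits b (digits b n) = n"
    using base by (simp add: of_digits_digits)
  show "of_digits b ` one_pair_words \<subseteq> one_occurrence b \<alpha>"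
  proof clarify
    fix w assume "w \<in> one_pair_words"
    moreover from this have eq: "digits b (of_digits b w) = w"
      using base by (auto simp: one_pair_words_def intro: digits_of_digits)
    moreover have "of_digits b w \<noteq> 0"
      using eq \<open>w \<in> one_pair_words\<close> by (metis (mono_tags, lifting) one_pair_words_def digits.simps mem_Collect_eq)
    ultimately show "of_digits b w \<in> one_occurrence b \<alpha>"
      by (simp add: one_occurrence_def occurrences_def one_pair_words_def pairs_def)
  qed
  show "digits b ` one_occurrence b \<alpha> \<subseteq> one_pair_words"
    using digits_less hd_digits_pos base
    by (auto simp: one_pair_words_def one_occurrence_def occurrences_def pairs_def)
qed

lemma of_digits_Cons_ge_1: "0 < n \<Longrightarrow> Suc 0 \<le> of_digits b (n # w)"
  using base by (simp add: of_digits_Cons Suc_le_eq)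

text \<open>The five pieces, in this order: the string starts with the pair and \<open>\<alpha>\<close> does not recur at once; no
\<open>\<alpha>\<close> follows two digits other than \<open>\<alpha>\<alpha>\<close>; the pair is formed by the second and third digits; the
third digit is an \<open>\<alpha>\<close> without a neighbouring \<open>\<alpha>\<close>; the pair is formed by the third and fourth digits.
The index set of the first piece has one element or none, because a leading \<open>\<alpha>\<close> must be nonzero.\<close>

lemma one_pair_words_decomp:
  "one_pair_words = prefixed {x. \<alpha> \<noteq> 0} (\<lambda>x::unit. [\<alpha>, \<alpha>]) (words 0)
     \<union> prefixed ({1..<b} \<times> {0..<b} - {(\<alpha>, \<alpha>)}) (\<lambda>(n1, n2). [n1, n2]) (words 1)
     \<union> prefixed ({1..<b} - {\<alpha>}) (\<lambda>n1. [n1, \<alpha>, \<alpha>]) (words 0)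
     \<union> (prefixed ({1..<b} \<times> ({0..<b} - {\<alpha>})) (\<lambda>(n1, n2). [n1, n2, \<alpha>]) (words 1)
     \<union> prefixed ({1..<b} \<times> ({0..<b} - {\<alpha>})) (\<lambda>(n1, n2). [n1, n2, \<alpha>, \<alpha>]) (words 0))"
  (is "_ = ?A1 \<union> ?A2 \<union> ?A3 \<union> (?A4 \<union> ?A5)")
proof
  show "?A1 \<union> ?A2 \<union> ?A3 \<union> (?A4 \<union> ?A5) \<subseteq> one_pair_words"
    using digit by (auto simp: prefixed_def one_pair_words_def words_def)
  show "one_pair_words \<subseteq> ?A1 \<union> ?A2 \<union> ?A3 \<union> (?A4 \<union> ?A5)"
  proof
    fix w assume w: "w \<in> one_pair_words"
    obtain n1 n2 r where r: "w = n1 # n2 # r"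
    proof (cases w)
      case Nil
      with w show ?thesis by (simp add: one_pair_words_def)
    next
      case (Cons n1 w')
      with w have "w' \<noteq> []" by (auto simp: one_pair_words_def)
      with Cons that show ?thesis by (cases w') auto
    qed
    consider "r = [] \<or> hd r \<noteq> \<alpha>" | s where "r = \<alpha> # s" "s = [] \<or> hd s \<noteq> \<alpha>" | t where "r = \<alpha> # \<alpha> # t"
      by (cases r; cases "tl r") auto
    then show "w \<in> ?A1 \<union> ?A2 \<union> ?A3 \<union> (?A4 \<union> ?A5)"
    proof cases
      case 1
      show ?thesis
      proof (cases "n1 = \<alpha> \<and> n2 = \<alpha>")
        case True
        then have "w \<in> ?A1"
          using 1 w r by (intro prefixedI[of "()" _ r]) (auto simp: one_pair_words_def words_def)
        then show ?thesis by blast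
      next
        case False
        then have "w \<in> ?A2"
          using 1 w r by (intro prefixedI[of "(n1, n2)" _ r]) (auto simp: one_pair_words_def words_def split: if_splits)
        then show ?thesis by blast
      qed
    next
      case 2
      show ?thesis
      proof (cases "n2 = \<alpha>")
        case True
        then have "w \<in> ?A3"
          using 2 w r by (intro prefixedI[of n1 _ s]) (auto simp: one_pair_words_def words_def split: if_splits)
        then show ?thesis by blast
      next
        case False
        then have "w \<in> ?A4"
          using 2 w r by (intro prefixedI[of "(n1, n2)" _ s]) (auto simp: one_pair_words_def words_def split: if_splits)
        then show ?thesis by blast
      qed
    next
      case 3
      then have "w \<in> ?A5"
        using w r by (intro prefixedI[of "(n1, n2)" _ t]) (auto simp: one_pair_words_def words_def split: if_splits)
      then show ?thesis by blast
    qed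
  qed
qed

lemma reciprocal_has_sum_one_occurrence:
  "((\<lambda>n. 1 / real n) has_sum
     ((\<Sum>x::unit | \<alpha> \<noteq> 0. tail_sum 0 (of_digits b [\<alpha>, \<alpha>]))
      + (\<Sum>(n1, n2) \<in> {1..<b} \<times> {0..<b} - {(\<alpha>, \<alpha>)}. tail_sum 1 (of_digits b [n1, n2]))
      + (\<Sum>n1 \<in> {1..<b} - {\<alpha>}. tail_sum 0 (of_digits b [n1, \<alpha>, \<alpha>]))
      + ((\<Sum>(n1, n2) \<in> {1..<b} \<times> ({0..<b} - {\<alpha>}). tail_sum 1 (of_digits b [n1, n2, \<alpha>]))
        + (\<Sum>(n1, n2) \<in> {1..<b} \<times> ({0..<b} - {\<alpha>}). tail_sum 0 (of_digits b [n1, n2, \<alpha>, \<alpha>])))))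
   (one_occurrence b \<alpha>)"
proof -
  let ?f = "\<lambda>w. 1 / real (of_digits b w)"
  have 1: "(?f has_sum (\<Sum>x::unit | \<alpha> \<noteq> 0. tail_sum 0 (of_digits b [\<alpha>, \<alpha>])))
      (prefixed {x. \<alpha> \<noteq> 0} (\<lambda>x::unit. [\<alpha>, \<alpha>]) (words 0))"
    by (rule prefixed_reciprocals) (auto simp: inj_on_def intro!: of_digits_Cons_ge_1 split: if_splits)
  have 2: "(?f has_sum (\<Sum>x \<in> {1..<b} \<times> {0..<b} - {(\<alpha>, \<alpha>)}. tail_sum 1 (of_digits b ((\<lambda>(n1, n2). [n1, n2]) x))))
      (prefixed ({1..<b} \<times> {0..<b} - {(\<alpha>, \<alpha>)}) (\<lambda>(n1, n2). [n1, n2]) (words 1))"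
    by (rule prefixed_reciprocals) (auto simp: inj_on_def intro!: of_digits_Cons_ge_1 split: if_splits)
  have 3: "(?f has_sum (\<Sum>n1 \<in> {1..<b} - {\<alpha>}. tail_sum 0 (of_digits b [n1, \<alpha>, \<alpha>])))
      (prefixed ({1..<b} - {\<alpha>}) (\<lambda>n1. [n1, \<alpha>, \<alpha>]) (words 0))"
    by (rule prefixed_reciprocals) (auto simp: inj_on_def intro!: of_digits_Cons_ge_1 split: if_splits)
  have 4: "(?f has_sum (\<Sum>x \<in> {1..<b} \<times> ({0..<b} - {\<alpha>}). tail_sum 1 (of_digits b ((\<lambda>(n1, n2). [n1, n2, \<alpha>]) x))))
      (prefixed ({1..<b} \<times> ({0..<b} - {\<alpha>})) (\<lambda>(n1, n2). [n1, n2, \<alpha>]) (words 1))"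
    by (rule prefixed_reciprocals) (auto simp: inj_on_def intro!: of_digits_Cons_ge_1 split: if_splits)
  have 5: "(?f has_sum (\<Sum>x \<in> {1..<b} \<times> ({0..<b} - {\<alpha>}). tail_sum 0 (of_digits b ((\<lambda>(n1, n2). [n1, n2, \<alpha>, \<alpha>]) x))))
      (prefixed ({1..<b} \<times> ({0..<b} - {\<alpha>})) (\<lambda>(n1, n2). [n1, n2, \<alpha>, \<alpha>]) (words 0))"
    by (rule prefixed_reciprocals) (auto simp: inj_on_def intro!: of_digits_Cons_ge_1 split: if_splits)
  have "(?f has_sum
     ((\<Sum>x::unit | \<alpha> \<noteq> 0. tail_sum 0 (of_digits b [\<alpha>, \<alpha>]))
      + (\<Sum>x \<in> {1..<b} \<times> {0..<b} - {(\<alpha>, \<alpha>)}. tail_sum 1 (of_digits b ((\<lambda>(n1, n2). [n1, n2]) x)))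
      + (\<Sum>n1 \<in> {1..<b} - {\<alpha>}. tail_sum 0 (of_digits b [n1, \<alpha>, \<alpha>]))
      + ((\<Sum>x \<in> {1..<b} \<times> ({0..<b} - {\<alpha>}). tail_sum 1 (of_digits b ((\<lambda>(n1, n2). [n1, n2, \<alpha>]) x)))
        + (\<Sum>x \<in> {1..<b} \<times> ({0..<b} - {\<alpha>}). tail_sum 0 (of_digits b ((\<lambda>(n1, n2). [n1, n2, \<alpha>, \<alpha>]) x)))))) one_pair_words"
    unfolding one_pair_words_decomp
    by (intro has_sum_Un_disjoint 1 2 3 4 5) (auto simp: prefixed_def words_def simp del: pairs_Cons)
  then show ?thesis
    unfolding has_sum_reindex_bij_betw[OF bij_betw_of_digits, of "\<lambda>n. 1 / real n", symmetric]
    by (simp add: case_prod_unfold)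
qed

end

theorem theorem17:
  fixes b \<alpha> :: nat and u v :: "nat \<Rightarrow> real"
  assumes "b > 1" and "\<alpha> < b"
    and "u_recurrence b \<alpha> u" and "v_recurrence b \<alpha> u v"
  shows "(\<forall>m. u m > 0) \<and> (\<forall>m. v m > 0)
    \<and> (\<forall>m. u (Suc m) < u m) \<and> (\<forall>m. v (Suc m) < v m)
    \<and> u \<longlonglongrightarrow> 0 \<and> v \<longlonglongrightarrow> 0
    \<and> (\<forall>x>1. summable (\<lambda>m. inv_power_term u x (Suc m)) \<and> summable (\<lambda>m. inv_power_term v x (Suc m)))
    \<and> (\<lambda>n. 1 / real n) summable_on one_occurrence b \<alpha>
    \<and> K1 b \<alpha> =
        (if \<alpha> \<noteq> 0 then U b u (of_digits b [\<alpha>, \<alpha>]) else 0)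
        + (\<Sum>(n1, n2) \<in> {1..<b} \<times> {0..<b} - {(\<alpha>, \<alpha>)}. V b v (of_digits b [n1, n2]))
        + (\<Sum>n1 \<in> {1..<b} - {\<alpha>}. U b u (of_digits b [n1, \<alpha>, \<alpha>]))
        + (\<Sum>(n1, n2) \<in> {1..<b} \<times> ({0..<b} - {\<alpha>}).
             V b v (of_digits b [n1, n2, \<alpha>]) + U b u (of_digits b [n1, n2, \<alpha>, \<alpha>]))"
proof -
  interpret digit_words b \<alpha>
    by unfold_locales (fact assms)+
  have u: "u = word_moment 0"
    using u_recurrence_unique[OF assms(1,3) u_recurrence_word_moment_0] .
  have v: "v = word_moment 1"
    using v_recurrence_unique[OF assms(1) _ v_recurrence_word_moment_1] assms(4) u by blast
  (* d is any digit other than \<alpha>; it makes the value of d \<alpha> positive, also if \<alpha> = 0. So not all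
     of the mass sits at 0, which strict positivity and strict decrease require. *)
  define d :: nat where "d = (if \<alpha> = 0 then 1 else 0)"
  have d: "d < b" "d \<noteq> \<alpha>" "\<alpha> + d * b > 0"
    using assms(1) by (auto simp: d_def)
  then have "of_digits b [d, \<alpha>] > 0" "of_digits b [d, \<alpha>, \<alpha>] > 0"
    by (auto simp: of_digits_Cons)
  then have wit: "[d, \<alpha>] \<in> words 0" "[d, \<alpha>, \<alpha>] \<in> words 1" "frac_val [d, \<alpha>] > 0" "frac_val [d, \<alpha>, \<alpha>] > 0"
    using assms(1,2) d by (auto simp: words_def frac_val_def)
  have "(\<forall>m. u m > 0) \<and> (\<forall>m. v m > 0) \<and> (\<forall>m. u (Suc m) < u m) \<and> (\<forall>m. v (Suc m) < v m)
      \<and> u \<longlonglongrightarrow> 0 \<and> v \<longlonglongrightarrow> 0"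
    unfolding u v word_moment_def
    using wit point_masses.moment_pos[OF word_masses] point_masses.moment_Suc_less[OF word_masses]
      point_masses.moment_tendsto_0[OF word_masses] by (metis le_numeral_extra(4) zero_le_one)
  moreover have "summable (\<lambda>m. inv_power_term (word_moment k) x (Suc m))" if "k \<le> 1" "x > 1" for k x
    using series_sums[OF that(1), of x] that(2) summable_Suc_iff[of "inv_power_term (word_moment k) x"] by (auto simp: sums_iff)
  then have "\<forall>x>1. summable (\<lambda>m. inv_power_term u x (Suc m)) \<and> summable (\<lambda>m. inv_power_term v x (Suc m))"
    unfolding u v by auto
  moreover have "(\<lambda>n. 1 / real n) summable_on one_occurrence b \<alpha>"
    using reciprocal_has_sum_one_occurrence by (rule has_sum_imp_summable)
  moreover have U: "U b u (of_digits b (n1 # w)) = tail_sum 0 (of_digits b (n1 # w))" 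
    and V: "V b v (of_digits b (n1 # w)) = tail_sum 1 (of_digits b (n1 # w))" if "n1 \<ge> 1" for n1 w
  proof -
    have "of_digits b (n1 # w) \<ge> 1"
      using that of_digits_Cons_ge_1 by simp
    then show "U b u (of_digits b (n1 # w)) = tail_sum 0 (of_digits b (n1 # w))"
      and "V b v (of_digits b (n1 # w)) = tail_sum 1 (of_digits b (n1 # w))"
      unfolding u v by (fact U_eq_tail_sum V_eq_tail_sum)+
  qed
  moreover have "K1 b \<alpha> =
        (if \<alpha> \<noteq> 0 then U b u (of_digits b [\<alpha>, \<alpha>]) else 0)
        + (\<Sum>(n1, n2) \<in> {1..<b} \<times> {0..<b} - {(\<alpha>, \<alpha>)}. V b v (of_digits b [n1, n2]))
        + (\<Sum>n1 \<in> {1..<b} - {\<alpha>}. U b u (of_digits b [n1, \<alpha>, \<alpha>]))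
        + (\<Sum>(n1, n2) \<in> {1..<b} \<times> ({0..<b} - {\<alpha>}).
             V b v (of_digits b [n1, n2, \<alpha>]) + U b u (of_digits b [n1, n2, \<alpha>, \<alpha>]))"
  proof -
    have 1: "(\<Sum>x::unit | \<alpha> \<noteq> 0. tail_sum 0 (of_digits b [\<alpha>, \<alpha>])) = (if \<alpha> \<noteq> 0 then U b u (of_digits b [\<alpha>, \<alpha>]) else 0)"
      by (simp add: U)
    have 2: "(\<Sum>(n1, n2) \<in> {1..<b} \<times> {0..<b} - {(\<alpha>, \<alpha>)}. tail_sum 1 (of_digits b [n1, n2]))
        = (\<Sum>(n1, n2) \<in> {1..<b} \<times> {0..<b} - {(\<alpha>, \<alpha>)}. V b v (of_digits b [n1, n2]))"
      by (intro sum.cong) (auto simp: V)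
    have 3: "(\<Sum>n1 \<in> {1..<b} - {\<alpha>}. tail_sum 0 (of_digits b [n1, \<alpha>, \<alpha>]))
        = (\<Sum>n1 \<in> {1..<b} - {\<alpha>}. U b u (of_digits b [n1, \<alpha>, \<alpha>]))"
      by (intro sum.cong) (auto simp: U)
    have 4: "(\<Sum>(n1, n2) \<in> {1..<b} \<times> ({0..<b} - {\<alpha>}). tail_sum 1 (of_digits b [n1, n2, \<alpha>]))
          + (\<Sum>(n1, n2) \<in> {1..<b} \<times> ({0..<b} - {\<alpha>}). tail_sum 0 (of_digits b [n1, n2, \<alpha>, \<alpha>]))
        = (\<Sum>(n1, n2) \<in> {1..<b} \<times> ({0..<b} - {\<alpha>}).
             V b v (of_digits b [n1, n2, \<alpha>]) + U b u (of_digits b [n1, n2, \<alpha>, \<alpha>]))"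
      unfolding sum.distrib[symmetric] by (intro sum.cong) (auto simp: U V)
    show ?thesis
      unfolding K1_def infsumI[OF reciprocal_has_sum_one_occurrence] 1 2 3 4 ..
  qed
  ultimately show ?thesis
    by blast
qed

end
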